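(* Let $A\in\mathbb{C}^{n\times n}$ have index $k$ and satisfy $\operatorname{rank}(A^{\sim}AA^{\sim})=\operatorname{rank}(A)$. Then $$\begin{aligned}A^{D,\mathfrak{m}}&=\lim_{\lambda\to0}A^{k}(\lambda I_n+A^{\mathfrak{m}}A^{k+1})^{-1}A^{\mathfrak{m}}\\&=\lim_{\lambda\to0}A^{k}A^{\mathfrak{m}}(\lambda I_n+A^{k+1}A^{\mathfrak{m}})^{-1}\\&=\lim_{\lambda\to0}(\lambda I_n+A^{k})^{-1}A^{k}A^{\mathfrak{m}}\\&=\lim_{\lambda\to0}(\lambda I_n+A^{k})^{-1}A^{k}(\lambda I_n+A^{\sim}A)^{-1}A^{\sim}.\end{aligned}$$
   Context: Limits are taken over $\lambda\neq0$ tending to $0$ (for all sufficiently small $\lambda\ne0$ the inverted matrices are nonsingular). The index of $A\in\mathbb{C}^{n\times n}$ is the smallest nonnegative integer $k$ with $\operatorname{rank}(A^{k+1})=\operatorname{rank}(A^{k})$. The Minkowski metric matrix of order $n$ is $G=\operatorname{diag}(1,-I_{n-1})$. For $A\in\mathbb{C}^{n\times n}$, the Minkowski adjoint is $A^{\sim}=GA^{*}G$, where $A^*$ is the conjugate transpose. The Drazin inverse $A^{D}$ of $A$ (of index $k$) is the unique $X$ with $XAX=X$, $AX=XA$, $A^{k+1}X=A^{k}$. The Minkowski inverse $A^{\mathfrak{m}}$ is the unique matrix $X$ (if it exists) with $AXA=A$, $XAX=X$, $(AX)^{\sim}=AX$, $(XA)^{\sim}=XA$; it exists if and only if $\operatorname{rank}(A^{\sim}AA^{\sim})=\operatorname{rank}(A)$.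 When it exists, the $\mathfrak{m}$-DMP inverse of $A$ is $A^{D,\mathfrak{m}}=A^{D}AA^{\mathfrak{m}}$. *)

theory Defs
  imports "HOL-Analysis.Analysis"
begin

text \<open>
  Square complex matrices of order \<open>n \<ge> 1\<close> have type \<open>complex^'n^'n\<close>. The Minkowski metric
  singles out the first coordinate, so the finite index type is linearly ordered and its
  least element plays the role of the index 1.
\<close>

text \<open>The power \<open>^\<close> on type \<open>vec\<close> acts entrywise, hence a separate matrix power.\<close>

primrec matpow :: "complex^'n^'n \<Rightarrow> nat \<Rightarrow> complex^'n^'n" where
  "matpow A 0 = mat 1"
| "matpow A (Suc m) = A ** matpow A m"

definition mat_index :: "complex^'n^'n \<Rightarrow> nat" where
  "mat_index A = (LEAST k. rank (matpow A (k + 1)) = rank (matpow A k))"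

definition conj_transpose :: "complex^'n^'n \<Rightarrow> complex^'n^'n" where
  "conj_transpose A = map_matrix cnj (transpose A)"

definition minkowski_metric :: "complex^'n::{finite,linorder}^'n::_" where
  "minkowski_metric =
     (\<chi> i j. if i = j then (if i = Min UNIV then 1 else - 1) else 0)"

definition minkowski_adjoint :: "complex^'n::{finite,linorder}^'n::_ \<Rightarrow> complex^'n::_^'n::_" where
  "minkowski_adjoint A = minkowski_metric ** conj_transpose A ** minkowski_metric"

definition is_drazin_inverse :: "complex^'n^'n \<Rightarrow> complex^'n^'n \<Rightarrow> bool" where
  "is_drazin_inverse A X \<longleftrightarrow>
     X ** A ** X = X \<and> A ** X = X ** A \<and>
     matpow A (mat_index A + 1) ** X = matpow A (mat_index A)"

definition drazin_inverse :: "complex^'n^'n \<Rightarrow> complex^'n^'n" where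
  "drazin_inverse A = (THE X. is_drazin_inverse A X)"

definition is_minkowski_inverse ::
    "complex^'n::{finite,linorder}^'n::_ \<Rightarrow> complex^'n::_^'n::_ \<Rightarrow> bool" where
  "is_minkowski_inverse A X \<longleftrightarrow>
     A ** X ** A = A \<and> X ** A ** X = X \<and>
     minkowski_adjoint (A ** X) = A ** X \<and> minkowski_adjoint (X ** A) = X ** A"

text \<open>
  The Minkowski inverse exists only if \<open>rank (A\<^sup>~ A A\<^sup>~) = rank A\<close>; the two functions below are
  meaningful only under that condition.
\<close>

definition minkowski_inverse :: "complex^'n::{finite,linorder}^'n::_ \<Rightarrow> complex^'n::_^'n::_" where
  "minkowski_inverse A = (THE X. is_minkowski_inverse A X)"

definition m_DMP_inverse :: "complex^'n::{finite,linorder}^'n::_ \<Rightarrow> complex^'n::_^'n::_" where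
  "m_DMP_inverse A = drazin_inverse A ** A ** minkowski_inverse A"

end

theory Submission
  imports Defs
begin

text \<open>
  Write \<open>P = A\<^sup>k\<close>, \<open>X\<close> for the Minkowski inverse, \<open>D\<close> for the Drazin inverse and \<open>A\<^sup>~\<close> for the
  Minkowski adjoint; the limit to be reached is \<open>D A X\<close>.

  Everything rests on one fact about resolvents (\<open>matrix_inv_shift_tendsto\<close>). Suppose \<open>B\<close> has a
  commuting inner inverse \<open>C\<close>, that is, \<open>B C = C B\<close> and \<open>B C B = B\<close>. Then the space is the direct
  sum of the kernel of \<open>B\<close> and its range, \<open>B\<close> acts bijectively on the range, and \<open>B C\<close> is the
  projection onto the range along the kernel. Hence \<open>\<lambda> I + B\<close> is invertible for all small
  \<open>\<lambda> \<noteq> 0\<close> and \<open>(\<lambda> I + B)\<^sup>-\<^sup>1 B\<close> tends to \<open>B C\<close>.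

  Two matrices have this property. For \<open>B = P\<close> take \<open>C = D\<^sup>k\<close>; then \<open>B C = D A\<close>, and multiplying
  by \<open>X\<close> on the right gives the third limit. For \<open>B = A\<^sup>~ A\<close> take \<open>C = X X\<^sup>~\<close>; then
  \<open>B C = X A\<close>, and because \<open>A\<^sup>~ = B X\<close> the matrices \<open>(\<lambda> I + A\<^sup>~ A)\<^sup>-\<^sup>1 A\<^sup>~\<close> tend to \<open>X A X = X\<close>.
  The fourth limit is the product of these two.

  The first two expressions are equal to the third for each small \<open>\<lambda> \<noteq> 0\<close>. This is the identity
  \<open>V (\<lambda> I + U V)\<^sup>-\<^sup>1 = (\<lambda> I + V U)\<^sup>-\<^sup>1 V\<close> (\<open>matrix_inv_push_through\<close>), used with \<open>U = X A\<close>,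
  \<open>V = P\<close>, where \<open>V U = P X A = P\<close>, and with \<open>U = A P\<close>, \<open>V = X\<close>.

  That the two generalized inverses exist is a statement about ranks: if \<open>X Y\<close> has the same rank
  as one of its factors, then that factor is recovered from \<open>X Y\<close> by a further multiplication, and
  the inverses are explicit products of such multipliers.
\<close>

section \<open>Rank and factorisation over a field\<close>

lemma rows_mult_subset_span:
  fixes X :: "'a::field^'n^'m" and Y :: "'a^'p^'n"
  shows "rows (X ** Y) \<subseteq> vec.span (rows Y)"
proof -
  have "row i (X ** Y) = (\<Sum>k\<in>UNIV. X$i$k *s row k Y)" for i
    by (simp add: vec_eq_iff row_def matrix_matrix_mult_def)
  moreover have "(\<Sum>k\<in>UNIV. X$i$k *s row k Y) \<in> vec.span (rows Y)" for i
    by (intro vec.span_sum vec.span_scale vec.span_base) (auto simp: rows_def)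
  ultimately show ?thesis by (auto simp: rows_def)
qed

text \<open>
  The vectors \<open>x\<close> with \<open>row i B = x M\<close> exist because the row combinations of \<open>M\<close> form a subspace
  containing its rows; stacked, these \<open>x\<close> are the rows of \<open>V\<close>.
\<close>

lemma left_factor_of_rows_subset:
  fixes M :: "'a::field^'p^'n" and B :: "'a^'p^'m"
  assumes "rows B \<subseteq> vec.span (rows M)"
  shows "\<exists>V. B = V ** M"
proof -
  have "vec.span (rows M) \<subseteq> range (\<lambda>x. transpose M *v x)"
  proof (rule vec.span_minimal)
    show "vec.subspace (range (\<lambda>x. transpose M *v x))"
      by (intro vec.subspace_image vec.subspace_UNIV)
    have "row i M = transpose M *v axis i 1" for i
      by (simp add: vec_eq_iff row_def matrix_vector_mult_def transpose_def axis_def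
          if_distrib cong: if_cong)
    then show "rows M \<subseteq> range (\<lambda>x. transpose M *v x)" by (auto simp: rows_def)
  qed
  with assms have "\<forall>i. \<exists>x. row i B = transpose M *v x" by (auto simp: rows_def)
  then obtain v where v: "\<And>i. row i B = transpose M *v v i" by metis
  have "B = (\<chi> i. v i) ** M"
    using v by (simp add: vec_eq_iff row_def matrix_vector_mult_def matrix_matrix_mult_def
        transpose_def mult.commute)
  then show ?thesis ..
qed

lemma rank_mult_le_right:
  fixes X :: "'a::field^'n^'m" and Y :: "'a^'p^'n"
  shows "rank (X ** Y) \<le> rank Y"
  unfolding row_rank_def_gen
  using vec.dim_subset[OF rows_mult_subset_span[of X Y]] by simp

text \<open>
  Row rank is at most column rank: with \<open>r\<close> basis vectors \<open>b\<close> of the column space, \<open>A\<close> is a sum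
  of \<open>r\<close> products of a column \<open>b\<close> with a row \<open>u b\<close>, and these \<open>r\<close> rows span the row space.
\<close>

lemma rank_le_rank_transpose:
  fixes A :: "'a::field^'n^'m"
  shows "rank A \<le> rank (transpose A)"
proof -
  obtain B where B: "B \<subseteq> columns A" "vec.independent B" "columns A \<subseteq> vec.span B"
      "card B = vec.dim (columns A)"
    using vec.basis_exists by blast
  have fin: "finite B" using B(2) vec.finiteI_independent by blast
  have "\<forall>j. \<exists>u. column j A = (\<Sum>b\<in>B. u b *s b)"
    using B(3) vec.span_finite[OF fin] by (fastforce simp: columns_def)
  then obtain u where u: "\<And>j. column j A = (\<Sum>b\<in>B. u j b *s b)" by metis
  have r: "row i A = (\<Sum>b\<in>B. b$i *s (\<chi> j. u j b))" for i
  proof -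
    have "A$i$j = (\<Sum>b\<in>B. u j b * b$i)" for j
      using arg_cong[OF u[of j], of "\<lambda>v. v$i"] by (simp add: column_def)
    then show ?thesis by (simp add: vec_eq_iff row_def mult.commute)
  qed
  have "row i A \<in> vec.span ((\<lambda>b. \<chi> j. u j b) ` B)" for i
    unfolding r by (intro vec.span_sum vec.span_scale vec.span_base imageI)
  then have "rows A \<subseteq> vec.span ((\<lambda>b. \<chi> j. u j b) ` B)"
    by (auto simp: rows_def)
  then have "vec.dim (rows A) \<le> card ((\<lambda>b. \<chi> j. u j b) ` B)"
    using fin by (intro vec.dim_le_card) auto
  also have "\<dots> \<le> card B" using fin by (rule card_image_le)
  finally show ?thesis using B(4) by (simp add: row_rank_def_gen rows_transpose)
qed

lemma rank_transpose_field:
  fixes A :: "'a::field^'n^'m"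
  shows "rank (transpose A) = rank A"
  using rank_le_rank_transpose[of A] rank_le_rank_transpose[of "transpose A"] by simp

lemma rank_mult_le_left:
  fixes X :: "'a::field^'n^'m" and Y :: "'a^'p^'n"
  shows "rank (X ** Y) \<le> rank X"
  using rank_mult_le_right[of "transpose Y" "transpose X"]
  by (simp add: rank_transpose_field flip: matrix_transpose_mul)

text \<open>
  The row space of \<open>X Y\<close> lies in that of \<open>Y\<close>, so equality of dimensions makes the two equal.
\<close>

lemma left_factor_of_rank_eq:
  fixes X :: "'a::field^'n^'m" and Y :: "'a^'p^'n"
  assumes "rank (X ** Y) = rank Y"
  shows "\<exists>V. Y = V ** (X ** Y)"
proof (rule left_factor_of_rows_subset)
  have "vec.span (rows (X ** Y)) = vec.span (rows Y)"
    using vec.subspace_dim_equal[of "vec.span (rows (X ** Y))" "vec.span (rows Y)"] assms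
      vec.span_minimal[OF rows_mult_subset_span[of X Y]]
    by (simp add: row_rank_def_gen)
  then show "rows Y \<subseteq> vec.span (rows (X ** Y))" using vec.span_superset by blast
qed

lemma right_factor_of_rank_eq:
  fixes X :: "'a::field^'n^'m" and Y :: "'a^'p^'n"
  assumes "rank (X ** Y) = rank X"
  shows "\<exists>W. X = X ** Y ** W"
proof -
  have "rank (transpose Y ** transpose X) = rank (transpose X)"
    using assms by (simp add: rank_transpose_field flip: matrix_transpose_mul)
  then obtain V where "transpose X = V ** (transpose Y ** transpose X)"
    using left_factor_of_rank_eq by blast
  then have "X = X ** Y ** transpose V"
    by (metis matrix_transpose_mul transpose_transpose)
  then show ?thesis ..
qed

text \<open>
  Entrywise conjugation is not linear, but it carries a linear combination to the combination of
  the conjugated vectors with conjugated coefficients, so a spanning set remains one.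
\<close>

lemma rank_map_matrix_cnj_le: "rank (map_matrix cnj A) \<le> rank A"
  for A :: "complex^'n^'m"
proof -
  define c :: "complex^'n \<Rightarrow> complex^'n" where "c v = (\<chi> j. cnj (v$j))" for v
  obtain B where B: "B \<subseteq> rows A" "vec.independent B" "rows A \<subseteq> vec.span B"
      "card B = vec.dim (rows A)"
    using vec.basis_exists by blast
  have fin: "finite B" using B(2) vec.finiteI_independent by blast
  have "row i (map_matrix cnj A) \<in> vec.span (c ` B)" for i
  proof -
    obtain u where "row i A = (\<Sum>b\<in>B. u b *s b)"
      using B(3) vec.span_finite[OF fin] by (fastforce simp: rows_def)
    then have "c (row i A) = (\<Sum>b\<in>B. cnj (u b) *s c b)"
      by (simp add: c_def vec_eq_iff)
    moreover have "c (row i A) = row i (map_matrix cnj A)"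
      by (simp add: c_def row_def vec_eq_iff)
    moreover have "(\<Sum>b\<in>B. cnj (u b) *s c b) \<in> vec.span (c ` B)"
      by (intro vec.span_sum vec.span_scale vec.span_base imageI)
    ultimately show ?thesis by simp
  qed
  then have "vec.dim (rows (map_matrix cnj A)) \<le> card (c ` B)"
    using fin by (intro vec.dim_le_card) (auto simp: rows_def)
  also have "\<dots> \<le> card B" using fin by (rule card_image_le)
  finally show ?thesis using B(4) by (simp add: row_rank_def_gen)
qed

section \<open>The Minkowski adjoint and the Minkowski inverse\<close>
lemma map_matrix_cnj_mult:
  "map_matrix cnj (A ** B) = map_matrix cnj A ** map_matrix cnj B"
  for A :: "complex^'n^'m" and B :: "complex^'p^'n"
  by (simp add: vec_eq_iff matrix_matrix_mult_def)

lemma conj_transpose_mult: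
  "conj_transpose (A ** B) = conj_transpose B ** conj_transpose A"
  by (simp add: conj_transpose_def matrix_transpose_mul map_matrix_cnj_mult)

lemma conj_transpose_conj_transpose: "conj_transpose (conj_transpose A) = A"
  by (simp add: conj_transpose_def vec_eq_iff transpose_def)

lemma minkowski_metric_square:
  "minkowski_metric ** minkowski_metric = (mat 1 :: complex^'n::{finite,linorder}^'n::_)"
proof -
  define e :: "'n \<Rightarrow> complex" where "e i = (if i = Min UNIV then 1 else - 1)" for i
  have G: "minkowski_metric $ i $ j = (if i = j then e i else 0)" for i j :: 'n
    by (simp add: minkowski_metric_def e_def)
  have "(\<Sum>k\<in>UNIV. (if i = k then e i else 0) * (if k = j then e k else 0))
      = (\<Sum>k\<in>UNIV. if k = i then (if i = j then e i * e i else 0) else 0)" for i j :: 'n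
    by (intro sum.cong) auto
  then show ?thesis
    by (simp add: vec_eq_iff matrix_matrix_mult_def mat_def G) (simp add: e_def)
qed

lemma conj_transpose_minkowski_metric: "conj_transpose minkowski_metric = minkowski_metric"
  by (auto simp: minkowski_metric_def conj_transpose_def vec_eq_iff transpose_def)

lemma minkowski_metric_cancel: "minkowski_metric ** (minkowski_metric ** X) = X"
  for X :: "complex^'n::{finite,linorder}^'n::_"
  by (simp add: matrix_mul_assoc minkowski_metric_square)

lemma minkowski_adjoint_mult:
  "minkowski_adjoint (A ** B) = minkowski_adjoint B ** minkowski_adjoint A"
  by (simp add: minkowski_adjoint_def conj_transpose_mult minkowski_metric_cancel
      flip: matrix_mul_assoc)

lemma minkowski_adjoint_involution: "minkowski_adjoint (minkowski_adjoint A) = A"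
  by (simp add: minkowski_adjoint_def conj_transpose_mult conj_transpose_minkowski_metric
      conj_transpose_conj_transpose minkowski_metric_cancel minkowski_metric_square
      flip: matrix_mul_assoc)

lemma rank_minkowski_adjoint: "rank (minkowski_adjoint A) = rank A"
proof -
  have le: "rank (minkowski_adjoint B) \<le> rank B" for B :: "complex^'n::{finite,linorder}^'n::_"
  proof -
    have "rank (minkowski_adjoint B) \<le> rank (conj_transpose B)"
      unfolding minkowski_adjoint_def
      using rank_mult_le_left rank_mult_le_right order_trans by blast
    also have "\<dots> \<le> rank B"
      unfolding conj_transpose_def
      using rank_map_matrix_cnj_le[of "transpose B"] by (simp add: rank_transpose_field)
    finally show ?thesis .
  qed
  show ?thesis using le[of A] le[of "minkowski_adjoint A"]
    by (simp add: minkowski_adjoint_involution)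
qed

text \<open>
  With \<open>N = A\<^sup>~ A A\<^sup>~\<close>, the rank condition yields \<open>A\<^sup>~ = V N = N W\<close>. The candidate is
  \<open>V N W\<close>, which is both \<open>V A\<^sup>~\<close> and \<open>A\<^sup>~ W\<close>. Taking adjoints of the two factorisations puts
  \<open>A X\<close> and \<open>X A\<close> in visibly self-adjoint form.
\<close>

lemma minkowski_inverse_exists:
  assumes "rank (minkowski_adjoint A ** A ** minkowski_adjoint A) = rank A"
  shows "\<exists>X. is_minkowski_inverse A X"
proof -
  let ?T = "minkowski_adjoint"
  have "rank (?T A ** A ** ?T A) = rank (?T A)"
    using assms by (simp add: rank_minkowski_adjoint)
  then obtain V W where V: "?T A = V ** (?T A ** A ** ?T A)"
    and W: "?T A = ?T A ** A ** ?T A ** W"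
    using left_factor_of_rank_eq right_factor_of_rank_eq by (metis matrix_mul_assoc)
  define X where "X = V ** ?T A"
  have X: "X = ?T A ** W" by (metis V W X_def matrix_mul_assoc)
  note a = minkowski_adjoint_mult minkowski_adjoint_involution
  have AW: "A = ?T W ** A ** ?T A ** A"
    using arg_cong[OF W, of ?T] by (simp add: a matrix_mul_assoc)
  have AV: "A = A ** ?T A ** A ** ?T V"
    using arg_cong[OF V, of ?T] by (simp add: a matrix_mul_assoc)
  have AX: "A ** X = ?T W ** A ** ?T A ** A ** ?T A ** W"
    using AW X by (metis matrix_mul_assoc)
  have XA: "X ** A = V ** ?T A ** A ** ?T A ** A ** ?T V"
    using AV X_def by (metis matrix_mul_assoc)
  have sAX: "?T (A ** X) = A ** X" unfolding AX by (simp add: a matrix_mul_assoc)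
  have sXA: "?T (X ** A) = X ** A" unfolding XA by (simp add: a matrix_mul_assoc)
  have "A ** X ** A = A"
    using sAX AW X by (simp add: a matrix_mul_assoc)
  moreover have "X ** A ** X = X"
    by (metis V X X_def W matrix_mul_assoc)
  ultimately show ?thesis using sAX sXA unfolding is_minkowski_inverse_def by blast
qed

text \<open>
  The Moore-Penrose argument uses only that the adjoint reverses products. Since
  \<open>A X = (A Y) (A X)\<close> with both factors self-adjoint, taking adjoints gives
  \<open>A X = (A X) (A Y) = A Y\<close>; likewise \<open>X A = Y A\<close>, and then \<open>X = X A X = Y A Y = Y\<close>.
\<close>

lemma minkowski_inverse_unique:
  assumes "is_minkowski_inverse A X" "is_minkowski_inverse A Y"
  shows "X = Y"
proof -
  have AX: "A ** X = A ** Y"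
    using assms unfolding is_minkowski_inverse_def
    by (metis matrix_mul_assoc minkowski_adjoint_mult)
  have XA: "X ** A = Y ** A"
    using assms unfolding is_minkowski_inverse_def
    by (metis matrix_mul_assoc minkowski_adjoint_mult)
  show ?thesis
    using assms AX XA unfolding is_minkowski_inverse_def by (metis matrix_mul_assoc)
qed

lemma minkowski_inverse_is_minkowski_inverse:
  assumes "rank (minkowski_adjoint A ** A ** minkowski_adjoint A) = rank A"
  shows "is_minkowski_inverse A (minkowski_inverse A)"
  unfolding minkowski_inverse_def
  using minkowski_inverse_exists[OF assms] minkowski_inverse_unique
  by (metis (no_types, lifting) theI)

section \<open>Matrix powers and the Drazin inverse\<close>
lemma matpow_commute:
  assumes "X ** Y = Y ** X"
  shows "matpow X m ** Y = Y ** matpow X m"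
proof (induction m)
  case (Suc m)
  then show ?case using assms by (simp, metis matrix_mul_assoc)
qed simp

lemma matpow_add: "matpow A (i + j) = matpow A i ** matpow A j"
  by (induction i) (simp_all add: matrix_mul_assoc)

text \<open>
  Without this the least-number definition of the index would say nothing: the ranks of the powers
  never increase and are natural numbers, so two consecutive ones agree.
\<close>

lemma rank_matpow_mat_index:
  "rank (matpow A (mat_index A + 1)) = rank (matpow A (mat_index A))"
proof -
  have dec: "rank (matpow A (Suc m)) \<le> rank (matpow A m)" for m
    by (simp add: rank_mult_le_right)
  have "\<exists>m. rank (matpow A (m + 1)) = rank (matpow A m)"
  proof (rule ccontr)
    assume "\<nexists>m. rank (matpow A (m + 1)) = rank (matpow A m)"
    then have lt: "rank (matpow A (Suc m)) < rank (matpow A m)" for m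
      using dec[of m] by (simp add: le_neq_implies_less)
    have "rank (matpow A m) + m \<le> rank (matpow A 0)" for m
    proof (induction m)
      case (Suc m)
      then show ?case using lt[of m] by linarith
    qed simp
    from this[of "Suc (rank (matpow A 0))"] show False by simp
  qed
  then show ?thesis unfolding mat_index_def by (rule LeastI_ex)
qed

text \<open>
  Equality of the ranks of \<open>P = A\<^sup>k\<close> and \<open>A P\<close> gives \<open>P = P A Y = Z A P\<close>. Iterating,
  \<open>P = A\<^sup>m P Y\<^sup>m = Z\<^sup>m P A\<^sup>m\<close> for every \<open>m\<close>, whence \<open>P Y\<^sup>m = Z\<^sup>m P\<close>. The matrix
  \<open>P Y\<^sup>k\<^sup>+\<^sup>1 = Z\<^sup>k\<^sup>+\<^sup>1 P\<close> is the Drazin inverse: its first form shows what \<open>A\<close> does on the left,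
  its second what \<open>A\<close> does on the right.
\<close>

lemma drazin_inverse_exists: "\<exists>X. is_drazin_inverse A X"
proof -
  define k where "k = mat_index A"
  define P where "P = matpow A k"
  have rk: "rank (A ** P) = rank P"
    using rank_matpow_mat_index[of A] by (simp add: k_def P_def)
  have com: "P ** A = A ** P" unfolding P_def by (rule matpow_commute) simp
  obtain Z where Z: "P = Z ** (A ** P)" using left_factor_of_rank_eq[OF rk] by blast
  obtain Y where Y: "P = P ** A ** Y"
    using right_factor_of_rank_eq[of P A] rk com by metis
  have PY: "P = matpow A m ** P ** matpow Y m" for m
  proof (induction m)
    case (Suc m)
    have "matpow A (Suc m) ** P ** matpow Y (Suc m)
        = matpow A m ** (A ** P ** Y) ** matpow Y m"
      using matpow_commute[of A A m] by (simp add: matrix_mul_assoc)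
    then show ?case using Suc Y com by simp
  qed simp
  have ZP: "P = matpow Z m ** P ** matpow A m" for m
  proof (induction m)
    case (Suc m)
    have "matpow Z (Suc m) ** P ** matpow A (Suc m)
        = matpow Z m ** (Z ** P ** A) ** matpow A m"
      using matpow_commute[of Z Z m] by (simp add: matrix_mul_assoc)
    moreover have "Z ** P ** A = P" using Z com by (metis matrix_mul_assoc)
    ultimately show ?case using Suc by simp
  qed simp
  have comm: "matpow A m ** P = P ** matpow A m" for m
    unfolding P_def by (simp add: add.commute flip: matpow_add)
  have sw: "P ** matpow Y m = matpow Z m ** P" for m
    by (metis PY ZP comm matrix_mul_assoc)
  define X where "X = P ** matpow Y (Suc k)"
  have X: "X = matpow Z (Suc k) ** P" by (simp only: X_def sw)
  have AX: "A ** X = P ** matpow Y k"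
    using Y com by (simp add: X_def matrix_mul_assoc)
  have XA: "X ** A = matpow Z k ** P"
  proof -
    have "X ** A = matpow Z k ** (Z ** (A ** P))"
      unfolding X using matpow_commute[of Z Z k] com
      by simp (metis matrix_mul_assoc)
    then show ?thesis using Z by simp
  qed
  have "A ** X = X ** A" using AX XA sw by simp
  moreover have "X ** A ** X = X"
  proof -
    have "X ** A ** X = matpow Z (Suc k) ** (P ** P ** matpow Y k)"
      by (metis AX X matrix_mul_assoc)
    also have "P ** P ** matpow Y k = P" using PY[of k] by (simp add: P_def)
    finally show ?thesis using X by simp
  qed
  moreover have "matpow A (k + 1) ** X = P"
    using PY[of "Suc k"] by (simp add: X_def matrix_mul_assoc)
  ultimately show ?thesis unfolding is_drazin_inverse_def P_def k_def by blast
qed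

text \<open>
  Only positive powers have this property: the power 0 gives the identity, whereas \<open>A X\<close> is in
  general just an idempotent.
\<close>

lemma drazin_matpow:
  assumes "X ** A ** X = X" "A ** X = X ** A"
  shows "matpow A (Suc j) ** matpow X (Suc j) = A ** X"
proof (induction j)
  case (Suc j)
  have "matpow A (Suc (Suc j)) ** matpow X (Suc (Suc j))
      = A ** (matpow A (Suc j) ** matpow X (Suc j)) ** X"
    using matpow_commute[of X X "Suc j"] by (metis matpow.simps(2) matrix_mul_assoc)
  also have "\<dots> = A ** X" using assms unfolding Suc by (metis matrix_mul_assoc)
  finally show ?case .
qed simp

text \<open>
  At index 0 the matrix \<open>A\<close> is invertible, \<open>A X\<close> is the identity, and the formula persists for
  the power 0.
\<close>

lemma drazin_matpow_index:
  assumes "is_drazin_inverse A X"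
  shows "matpow A (mat_index A) ** matpow X (mat_index A) = A ** X"
proof (cases "mat_index A")
  case 0
  then have "A ** X = mat 1" using assms by (auto simp: is_drazin_inverse_def)
  then show ?thesis using 0 by simp
next
  case (Suc j)
  show ?thesis
    unfolding Suc using assms by (intro drazin_matpow) (simp_all add: is_drazin_inverse_def)
qed

lemma drazin_absorb:
  assumes "is_drazin_inverse A X"
  shows "X ** A ** matpow A (mat_index A) = matpow A (mat_index A)"
    and "matpow A (mat_index A) ** A ** X = matpow A (mat_index A)"
proof -
  let ?P = "matpow A (mat_index A)"
  have c: "?P ** A = A ** ?P" by (rule matpow_commute) simp
  have d: "?P ** X = X ** ?P"
    using assms by (intro matpow_commute) (simp add: is_drazin_inverse_def)
  have e: "A ** ?P ** X = ?P" using assms by (simp add: is_drazin_inverse_def)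
  then show "?P ** A ** X = ?P" using c by simp
  have "A ** X = X ** A" using assms by (simp add: is_drazin_inverse_def)
  then show "X ** A ** ?P = ?P" using d e by (metis matrix_mul_assoc)
qed

text \<open>
  The projection \<open>A X\<close> is \<open>X\<^sup>k A\<^sup>k\<close>, and \<open>A Y\<close> fixes \<open>A\<^sup>k\<close> on the right, so \<open>A X A Y = A X\<close>;
  symmetrically \<open>A X\<close> fixes \<open>A Y = A\<^sup>k Y\<^sup>k\<close> on the left, so \<open>A X A Y = A Y\<close>. Hence both
  projections agree, and so do \<open>X = X A X\<close> and \<open>Y = Y A Y\<close>.
\<close>

lemma drazin_inverse_unique:
  assumes X: "is_drazin_inverse A X" and Y: "is_drazin_inverse A Y"
  shows "X = Y"
proof -
  let ?k = "mat_index A"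
  let ?P = "matpow A ?k"
  have cX: "A ** X = X ** A" and cY: "A ** Y = Y ** A"
    using assms by (simp_all add: is_drazin_inverse_def)
  have 1: "A ** X = matpow X ?k ** ?P"
    using drazin_matpow_index[OF X] matpow_commute[of X ?P ?k] matpow_commute[OF cX, of ?k]
    by simp
  have "A ** X = matpow X ?k ** (?P ** A ** Y)"
    using 1 drazin_absorb(2)[OF Y] by simp
  also have "\<dots> = A ** X ** A ** Y" using 1 by (simp add: matrix_mul_assoc)
  also have "\<dots> = X ** A ** (?P ** matpow Y ?k)"
    using cX drazin_matpow_index[OF Y] by (simp add: matrix_mul_assoc)
  also have "\<dots> = ?P ** matpow Y ?k" using drazin_absorb(1)[OF X] by (simp add: matrix_mul_assoc)
  also have "\<dots> = A ** Y" by (rule drazin_matpow_index[OF Y])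
  finally have "A ** X = A ** Y" .
  then show ?thesis
    using assms unfolding is_drazin_inverse_def by (metis matrix_mul_assoc)
qed

lemma drazin_inverse_is_drazin_inverse: "is_drazin_inverse A (drazin_inverse A)"
  unfolding drazin_inverse_def
  using drazin_inverse_exists drazin_inverse_unique by (metis (no_types, lifting) theI)

section \<open>Resolvents near zero\<close>
lemma bounded_bilinear_matrix_mult:
  "bounded_bilinear ((**) :: complex^'n^'m \<Rightarrow> complex^'p^'n \<Rightarrow> complex^'p^'m)"
  unfolding bilinear_conv_bounded_bilinear[symmetric] bilinear_def
  by (auto intro!: linearI simp: vec_eq_iff matrix_matrix_mult_def sum.distrib
      distrib_left distrib_right scaleR_sum_right)

lemma mat_tendsto_0: "((mat :: complex \<Rightarrow> complex^'n^'n) \<longlongrightarrow> 0) (at 0)"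
proof (intro vec_tendstoI)
  fix i j :: 'n
  show "((\<lambda>l. mat l $ i $ j) \<longlongrightarrow> (0 :: complex^'n^'n) $ i $ j) (at 0)"
    by (cases "i = j") (simp_all add: mat_def)
qed

lemma mat_mult_commute: "mat l ** X = X ** mat l" for X :: "complex^'n^'n"
  by (simp add: vec_eq_iff matrix_matrix_mult_def mat_def if_distrib[of "\<lambda>c. c * _"]
      if_distrib[of "\<lambda>c. _ * c"] mult.commute cong: if_cong)

lemma mat_mult_vector: "mat l *v x = l *s x" for x :: "complex^'n"
  by (simp add: vec_eq_iff matrix_vector_mult_def mat_def if_distrib[of "\<lambda>c. c * _"]
      cong: if_cong)

lemma norm_vector_smult: "norm (l *s x) = norm l * norm x" for x :: "complex^'n"
  by (simp add: norm_vec_def norm_mult L2_set_right_distrib)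

lemma invertible_iff_kernel:
  "invertible M \<longleftrightarrow> (\<forall>x. M *v x = 0 \<longrightarrow> x = 0)" for M :: "complex^'n^'n"
  by (simp add: invertible_left_inverse matrix_left_invertible_ker)

lemma matrix_inv_mult:
  assumes "invertible M"
  shows "M ** matrix_inv M = mat 1" "matrix_inv M ** M = mat 1"
  using someI_ex[OF assms[unfolded invertible_def]] unfolding matrix_inv_def by blast+

lemma shift_intertwine: "(mat l + V ** U) ** V = V ** (mat l + U ** V)"
  for U V :: "complex^'n^'n"
proof -
  have "(mat l + V ** U) ** V = mat l ** V + V ** U ** V" by (rule bounded_bilinear.add_left[OF bounded_bilinear_matrix_mult])
  also have "\<dots> = V ** mat l + V ** (U ** V)"
    by (simp only: mat_mult_commute[of l V] matrix_mul_assoc)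
  also have "\<dots> = V ** (mat l + U ** V)" by (rule matrix_add_ldistrib[symmetric])
  finally show ?thesis .
qed

text \<open>
  A kernel vector \<open>x\<close> of \<open>l + U V\<close> is sent by \<open>V\<close> to a kernel vector of \<open>l + V U\<close>. So \<open>V x = 0\<close>,
  and what remains of the equation for \<open>x\<close> is \<open>l x = 0\<close>.
\<close>

lemma invertible_shift_push_through:
  fixes U V :: "complex^'n^'n"
  assumes "l \<noteq> 0" "invertible (mat l + V ** U)"
  shows "invertible (mat l + U ** V)"
  unfolding invertible_iff_kernel
proof (intro allI impI)
  fix x assume x: "(mat l + U ** V) *v x = 0"
  have "(mat l + V ** U) *v (V *v x) = V *v ((mat l + U ** V) *v x)"
    by (simp only: matrix_vector_mul_assoc shift_intertwine)
  then have "V *v x = 0"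
    using assms(2) x unfolding invertible_iff_kernel by simp
  then have "l *s x = 0"
    using x by (simp add: matrix_vector_mult_add_rdistrib mat_mult_vector
        flip: matrix_vector_mul_assoc)
  then show "x = 0" using assms(1) by simp
qed

lemma matrix_inv_push_through:
  fixes U V :: "complex^'n^'n"
  assumes "invertible (mat l + V ** U)" "invertible (mat l + U ** V)"
  shows "V ** matrix_inv (mat l + U ** V) = matrix_inv (mat l + V ** U) ** V"
proof -
  have "(mat l + V ** U) ** V = V ** (mat l + U ** V)"
    by (rule shift_intertwine)
  then show ?thesis
    using matrix_inv_mult[OF assms(1)] matrix_inv_mult[OF assms(2)]
    by (metis matrix_mul_assoc matrix_mul_lid matrix_mul_rid)
qed

text \<open>
  An error bound relative to the unknown value \<open>f x\<close> bounds \<open>f x\<close> itself: once \<open>c x < 1/2\<close>, the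
  triangle inequality gives \<open>norm (f x) \<le> 2 * norm a\<close>. This makes it possible to pass to the limit
  of an inverse matrix without knowing that inversion is continuous.
\<close>

lemma tendsto_of_relative_error:
  fixes f :: "'a \<Rightarrow> 'b::real_normed_vector"
  assumes "(c \<longlongrightarrow> 0) F" and le: "\<forall>\<^sub>F x in F. norm (f x - a) \<le> c x * norm (f x)"
  shows "(f \<longlongrightarrow> a) F"
proof (rule Lim_transform2)
  show "((\<lambda>_. a) \<longlongrightarrow> a) F" by simp
  have "\<forall>\<^sub>F x in F. c x < 1/2" using assms(1) by (rule order_tendstoD) simp
  with le have "\<forall>\<^sub>F x in F. norm (a - f x) \<le> \<bar>c x\<bar> * (2 * norm a)"
  proof eventually_elim
    case (elim x)
    have "norm (f x) \<le> norm a + norm (f x - a)" using norm_triangle_sub by blast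
    also have "c x * norm (f x) \<le> 1/2 * norm (f x)" using elim(2) by (intro mult_right_mono) auto
    then have "norm a + norm (f x - a) \<le> norm a + norm (f x) / 2" using elim(1) by simp
    finally have "norm (f x) \<le> 2 * norm a" by simp
    then have "c x * norm (f x) \<le> \<bar>c x\<bar> * (2 * norm a)" by (intro mult_mono) auto
    then show ?case using elim(1) by (simp add: norm_minus_commute)
  qed
  moreover have "((\<lambda>x. \<bar>c x\<bar> * (2 * norm a)) \<longlongrightarrow> 0) F"
    using assms(1) by (auto intro!: tendsto_eq_intros)
  ultimately show "((\<lambda>x. a - f x) \<longlongrightarrow> 0) F" by (rule Lim_null_comparison)
qed

text \<open>
  If \<open>B x = - l x\<close> with \<open>l \<noteq> 0\<close>, then \<open>x\<close> lies in the range of \<open>B\<close>, on which \<open>C\<close> inverts \<open>B\<close>, so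
  \<open>x = C B x = - l C x\<close>. For \<open>l\<close> small compared with the norm of \<open>C\<close> this forces \<open>x = 0\<close>.
\<close>

lemma eventually_invertible_shift:
  fixes B C :: "complex^'n^'n"
  assumes "B ** C = C ** B" "B ** C ** B = B"
  shows "\<forall>\<^sub>F l in at 0. invertible (mat l + B)"
proof -
  obtain K where K: "\<And>x. norm (C *v x) \<le> norm x * K" and "K > 0"
    using bounded_linear.pos_bounded[OF matrix_vector_mul_bounded_linear[of C]] by blast
  have "\<forall>\<^sub>F l::complex in at 0. l \<noteq> 0 \<and> norm l * K < 1"
  proof (rule eventually_conj)
    have "((\<lambda>l::complex. norm l * K) \<longlongrightarrow> 0) (at 0)" by (auto intro!: tendsto_eq_intros)
    then show "\<forall>\<^sub>F l::complex in at 0. norm l * K < 1" by (rule order_tendstoD) simp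
  qed (simp add: eventually_at_filter)
  then show ?thesis
  proof eventually_elim
    case (elim l)
    show ?case unfolding invertible_iff_kernel
    proof (intro allI impI)
      fix x assume "(mat l + B) *v x = 0"
      then have Bx: "B *v x = - (l *s x)"
        by (simp add: matrix_vector_mult_add_rdistrib mat_mult_vector add_eq_0_iff)
      have "l *s (B *v (C *v x)) = - (B *v (C *v (B *v x)))"
        by (simp add: Bx vec.neg vec.scale)
      also have "\<dots> = l *s x"
      proof -
        have "B *v (C *v (B *v x)) = B *v x"
          using assms(2) by (simp add: matrix_vector_mul_assoc matrix_mul_assoc)
        then show ?thesis using Bx by simp
      qed
      finally have "B *v (C *v x) = x" using elim by simp
      then have "x = C *v (B *v x)" using assms(1) by (metis matrix_vector_mul_assoc)
      then have "x = - (l *s (C *v x))" by (simp add: Bx vec.neg vec.scale)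
      then have "norm x = norm l * norm (C *v x)" by (metis norm_minus_cancel norm_vector_smult)
      also have "\<dots> \<le> (norm l * K) * norm x"
        using mult_left_mono[OF K[of x], of "norm l"] by (simp add: ac_simps)
      finally have "(1 - norm l * K) * norm x \<le> 0" by (simp add: algebra_simps)
      then show "x = 0" using elim by (simp add: mult_le_0_iff)
    qed
  qed
qed

text \<open>
  For \<open>R = (l + B)\<^sup>-\<^sup>1 B\<close> one has \<open>(l + B) B C = B + l B C\<close>, that is, \<open>B C = R + R (l C)\<close>. The
  error \<open>R - B C\<close> is therefore small relative to \<open>R\<close>.
\<close>

lemma matrix_inv_shift_tendsto:
  fixes B C :: "complex^'n^'n"
  assumes BC: "B ** C = C ** B" and BCB: "B ** C ** B = B"
  shows "((\<lambda>l. matrix_inv (mat l + B) ** B) \<longlongrightarrow> B ** C) (at 0)"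
proof -
  obtain K where K: "K > 0" "\<And>(X :: complex^'n^'n) (Y :: complex^'n^'n).
      norm (X ** Y) \<le> norm X * norm Y * K"
    using bounded_bilinear.pos_bounded[OF bounded_bilinear_matrix_mult] by metis
  show ?thesis
  proof (rule tendsto_of_relative_error)
    show "((\<lambda>l. norm (C ** mat l) * K) \<longlongrightarrow> 0) (at 0)"
      by (intro tendsto_mult_left_zero tendsto_norm_zero mat_tendsto_0
          bounded_bilinear.tendsto_right_zero[OF bounded_bilinear_matrix_mult])
    show "\<forall>\<^sub>F l in at 0. norm (matrix_inv (mat l + B) ** B - B ** C)
        \<le> norm (C ** mat l) * K * norm (matrix_inv (mat l + B) ** B)"
      using eventually_invertible_shift[OF assms]
    proof eventually_elim
      case (elim l)
      let ?S = "matrix_inv (mat l + B)"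
      have "(mat l + B) ** (B ** C) = B + B ** C ** mat l"
      proof -
        have "(mat l + B) ** (B ** C) = mat l ** (B ** C) + B ** (B ** C)"
          by (rule bounded_bilinear.add_left[OF bounded_bilinear_matrix_mult])
        moreover have "mat l ** (B ** C) = B ** C ** mat l" by (rule mat_mult_commute)
        moreover have "B ** (B ** C) = B" using BC BCB by (metis matrix_mul_assoc)
        ultimately show ?thesis by simp
      qed
      then have "B ** C = ?S ** (B + B ** C ** mat l)"
        using matrix_inv_mult(2)[OF elim] by (metis matrix_mul_assoc matrix_mul_lid)
      also have "\<dots> = ?S ** B + ?S ** B ** (C ** mat l)"
        by (simp add: matrix_add_ldistrib matrix_mul_assoc)
      finally have "?S ** B - B ** C = - (?S ** B ** (C ** mat l))"
        by (simp only: diff_add_eq_diff_diff_swap) simp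
      then show ?case using K(2)[of "?S ** B" "C ** mat l"] by (simp add: ac_simps)
    qed
  qed
qed

section \<open>Limit representations\<close>

text \<open>
  The matrix \<open>X X\<^sup>~\<close> is a commuting inner inverse of \<open>A\<^sup>~ A\<close>, both products being \<open>X A\<close>, since
  self-adjointness of \<open>A X\<close> and \<open>X A\<close> reads \<open>X\<^sup>~ A\<^sup>~ = A X\<close> and \<open>A\<^sup>~ X\<^sup>~ = X A\<close>.
  Moreover \<open>A\<^sup>~ = A\<^sup>~ A X\<close>, so the resolvent limit applies after multiplication by \<open>X\<close>.
\<close>

lemma minkowski_regularization_tendsto:
  fixes A X :: "complex^'n::{finite,linorder}^'n::_"
  assumes "is_minkowski_inverse A X"
  shows "\<forall>\<^sub>F l in at 0. invertible (mat l + minkowski_adjoint A ** A)"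
    and "((\<lambda>l. matrix_inv (mat l + minkowski_adjoint A ** A) ** minkowski_adjoint A)
      \<longlongrightarrow> X) (at 0)"
proof -
  let ?T = "minkowski_adjoint"
  define B where "B = ?T A ** A"
  define C where "C = X ** ?T X"
  have m: "A ** X ** A = A" "X ** A ** X = X" "?T (A ** X) = A ** X" "?T (X ** A) = X ** A"
    using assms by (simp_all add: is_minkowski_inverse_def)
  have TX: "?T X ** ?T A = A ** X" "?T A ** ?T X = X ** A"
    using m(3,4) by (simp_all add: minkowski_adjoint_mult)
  have TA: "?T A = ?T A ** A ** X"
    using minkowski_adjoint_mult[of "A ** X" A] m(1,3) by (simp add: matrix_mul_assoc)
  have BC: "B ** C = X ** A"
  proof -
    have "B ** C = (?T A ** A ** X) ** ?T X" by (simp add: B_def C_def matrix_mul_assoc)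
    then show ?thesis using TA TX by simp
  qed
  have CB: "C ** B = X ** A"
  proof -
    have "C ** B = X ** (?T X ** ?T A) ** A" by (simp add: B_def C_def matrix_mul_assoc)
    then show ?thesis using TX m by (simp add: matrix_mul_assoc)
  qed
  have comm: "B ** C = C ** B" using BC CB by simp
  have BCB: "B ** C ** B = B"
  proof -
    have "B ** (C ** B) = ?T A ** (A ** X ** A)"
      unfolding CB by (simp add: B_def matrix_mul_assoc)
    then show ?thesis using m(1) by (simp add: B_def matrix_mul_assoc)
  qed
  show "\<forall>\<^sub>F l in at 0. invertible (mat l + ?T A ** A)"
    using eventually_invertible_shift[OF comm BCB] by (simp add: B_def)
  have "((\<lambda>l. matrix_inv (mat l + B) ** B ** X) \<longlongrightarrow> B ** C ** X) (at 0)"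
    by (intro bounded_bilinear.tendsto[OF bounded_bilinear_matrix_mult]
        matrix_inv_shift_tendsto[OF comm BCB] tendsto_const)
  moreover have "B ** C ** X = X" using BC m by simp
  moreover have "S ** B ** X = S ** ?T A" for S :: "complex^'n::_^'n::_"
    using TA by (metis B_def matrix_mul_assoc)
  ultimately show "((\<lambda>l. matrix_inv (mat l + ?T A ** A) ** ?T A) \<longlongrightarrow> X) (at 0)"
    by (simp flip: B_def)
qed

theorem theorem4p6:
  fixes A :: "complex^'n::{finite,linorder}^'n::_" and k :: nat
  assumes "mat_index A = k"
    and "rank (minkowski_adjoint A ** A ** minkowski_adjoint A) = rank A"
  shows
    "(\<forall>\<^sub>F l :: complex in at 0.
        invertible (mat l + minkowski_inverse A ** matpow A (k + 1)) \<and>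
        invertible (mat l + matpow A (k + 1) ** minkowski_inverse A) \<and>
        invertible (mat l + matpow A k) \<and>
        invertible (mat l + minkowski_adjoint A ** A)) \<and>
     ((\<lambda>l :: complex.
        matpow A k ** matrix_inv (mat l + minkowski_inverse A ** matpow A (k + 1))
          ** minkowski_inverse A)
        \<longlongrightarrow> m_DMP_inverse A) (at 0) \<and>
     ((\<lambda>l :: complex.
        matpow A k ** minkowski_inverse A
          ** matrix_inv (mat l + matpow A (k + 1) ** minkowski_inverse A))
        \<longlongrightarrow> m_DMP_inverse A) (at 0) \<and>
     ((\<lambda>l :: complex.
        matrix_inv (mat l + matpow A k) ** matpow A k ** minkowski_inverse A)
        \<longlongrightarrow> m_DMP_inverse A) (at 0) \<and>
     ((\<lambda>l :: complex.
        matrix_inv (mat l + matpow A k) ** matpow A k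
          ** matrix_inv (mat l + minkowski_adjoint A ** A) ** minkowski_adjoint A)
        \<longlongrightarrow> m_DMP_inverse A) (at 0)"
proof -
  define X where "X = minkowski_inverse A"
  define D where "D = drazin_inverse A"
  define P where "P = matpow A k"
  define B where "B = minkowski_adjoint A ** A"
  have X: "is_minkowski_inverse A X"
    unfolding X_def by (rule minkowski_inverse_is_minkowski_inverse[OF assms(2)])
  have D: "is_drazin_inverse A D"
    unfolding D_def by (rule drazin_inverse_is_drazin_inverse)
  have AXA: "A ** X ** A = A" using X by (simp add: is_minkowski_inverse_def)
  have AD: "A ** D = D ** A" using D by (simp add: is_drazin_inverse_def)
  have PA: "P ** A = A ** P" unfolding P_def by (rule matpow_commute) simp
  have DAP: "D ** A ** P = P" and PAD: "P ** A ** D = P"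
    using drazin_absorb[OF D] by (simp_all add: P_def assms(1))
  \<comment> \<open>Since \<open>P = D P A\<close>, the inner factor \<open>A X A\<close> appears and collapses.\<close>
  have PXA: "P ** X ** A = P"
    by (metis AXA DAP PA matrix_mul_assoc)
  have power: "matpow A (k + 1) = A ** P" by (simp add: P_def)
  define C where "C = matpow D k"
  have PC: "P ** C = D ** A"
    using drazin_matpow_index[OF D] AD by (simp add: P_def C_def assms(1))
  have DP: "D ** P = P ** D"
    unfolding P_def using matpow_commute[of A D k] AD by simp
  have CP: "P ** C = C ** P"
    unfolding C_def using matpow_commute[of D P k] DP by simp
  have PCP: "P ** C ** P = P" using PC DAP by simp

  have inv3: "\<forall>\<^sub>F l in at 0. invertible (mat l + P)"
    by (rule eventually_invertible_shift[OF CP PCP])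
  have inv4: "\<forall>\<^sub>F l in at 0. invertible (mat l + B)"
    unfolding B_def by (rule minkowski_regularization_tendsto(1)[OF X])
  have inv12: "\<forall>\<^sub>F l in at 0. l \<noteq> 0 \<and> invertible (mat l + P) \<and>
      invertible (mat l + X ** (A ** P)) \<and> invertible (mat l + A ** P ** X)"
    using inv3 eventually_neq_at_within[of "0 :: complex" 0 UNIV]
  proof eventually_elim
    case (elim l)
    have "invertible (mat l + P ** (X ** A))" using elim(1) PXA by (simp only: matrix_mul_assoc)
    then have "invertible (mat l + X ** A ** P)"
      by (rule invertible_shift_push_through[OF elim(2)])
    then have 1: "invertible (mat l + X ** (A ** P))" by (simp only: matrix_mul_assoc)
    have "invertible (mat l + A ** P ** X)"
      by (rule invertible_shift_push_through[OF elim(2) 1])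
    then show ?case using elim 1 by blast
  qed

  note mult_tendsto = bounded_bilinear.tendsto[OF bounded_bilinear_matrix_mult]
  have dmp: "m_DMP_inverse A = P ** C ** X"
    by (simp add: m_DMP_inverse_def PC X_def D_def)
  have proj: "((\<lambda>l. matrix_inv (mat l + P) ** P) \<longlongrightarrow> P ** C) (at 0)"
    by (rule matrix_inv_shift_tendsto[OF CP PCP])
  have lim3: "((\<lambda>l. matrix_inv (mat l + P) ** P ** X) \<longlongrightarrow> m_DMP_inverse A) (at 0)"
    unfolding dmp by (intro mult_tendsto proj tendsto_const)
  have lim4: "((\<lambda>l. matrix_inv (mat l + P) ** P
      ** (matrix_inv (mat l + B) ** minkowski_adjoint A)) \<longlongrightarrow> m_DMP_inverse A) (at 0)"
    unfolding dmp B_def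
    by (intro mult_tendsto proj minkowski_regularization_tendsto(2)[OF X])
  \<comment> \<open>\<open>P\<close> slides through the inverse, with \<open>P X A = P\<close> on the other side.\<close>
  have eq1: "\<forall>\<^sub>F l in at 0. matrix_inv (mat l + P) ** P ** X
      = P ** matrix_inv (mat l + X ** (A ** P)) ** X"
    using inv12
  proof eventually_elim
    case (elim l)
    have "P ** matrix_inv (mat l + (X ** A) ** P) = matrix_inv (mat l + P ** (X ** A)) ** P"
      using elim PXA by (intro matrix_inv_push_through) (simp_all add: matrix_mul_assoc)
    then show ?case using PXA by (simp add: matrix_mul_assoc)
  qed
  have lim1: "((\<lambda>l. P ** matrix_inv (mat l + X ** (A ** P)) ** X)
      \<longlongrightarrow> m_DMP_inverse A) (at 0)"
    by (rule Lim_transform_eventually[OF lim3 eq1])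
  have eq2: "\<forall>\<^sub>F l in at 0. P ** matrix_inv (mat l + X ** (A ** P)) ** X
      = P ** X ** matrix_inv (mat l + A ** P ** X)"
    using inv12
  proof eventually_elim
    case (elim l)
    then have "X ** matrix_inv (mat l + A ** P ** X) = matrix_inv (mat l + X ** (A ** P)) ** X"
      by (intro matrix_inv_push_through) simp_all
    then show ?case by (metis matrix_mul_assoc)
  qed
  have lim2: "((\<lambda>l. P ** X ** matrix_inv (mat l + A ** P ** X))
      \<longlongrightarrow> m_DMP_inverse A) (at 0)"
    by (rule Lim_transform_eventually[OF lim1 eq2])
  have "\<forall>\<^sub>F l in at 0. invertible (mat l + X ** (A ** P)) \<and> invertible (mat l + A ** P ** X) \<and>
      invertible (mat l + P) \<and> invertible (mat l + B)"
    using inv12 inv4 by eventually_elim simp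
  then show ?thesis
    unfolding power X_def[symmetric] P_def[symmetric] B_def[symmetric]
    using lim1 lim2 lim3 lim4 by (simp add: matrix_mul_assoc)
qed

end
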